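(* Let $\{\mathcal M_\theta=(\pi_{0,\theta},K_\theta,g_\theta):\theta\in\Theta\}$ be a parametric family of state-space models on $\mathcal X\subseteq\mathbb R^{d_x}$ with fixed observations $y_{1:T}$. Assume: (A) for every $\theta\in\Theta$ and $t\ge1$, $g_{t,\theta}$ is continuous and bounded, and $K_{t,\theta}$ is continuous in total variation (for every $x\in\mathcal X$ and $\epsilon>0$ there is $\delta>0$, depending on $\epsilon,x,t$ and $\theta$, with $\|K_{t,\theta}(x,\cdot)-K_{t,\theta}(x',\cdot)\|_{TV}\le\epsilon$ whenever $x'\in\mathcal X$, $\|x-x'\|\le\delta$); (B) there are finite constants $C_0$ and $G_t,\kappa_t$ ($t\ge1$) such that for all $\theta,\theta'\in\Theta$, $x\in\mathcal X$, $t\geq 1$: $\|\pi_{0,\theta}-\pi_{0,\theta'}\|_{TV}\le C_0\|\theta-\theta'\|$, $\|g_{t,\theta}-g_{t,\theta'}\|_\infty\le G_t\|\theta-\theta'\|$, and $\|K_{t,\theta}(x,\cdot)-K_{t,\theta'}(x,\cdot)\|_{TV}\le\kappa_t\|\theta-\theta'\|$. Let $L_T<\infty$ be the Lipschitz constant of the evidence, i.e. $|p_T(y_{1:T}\mid\mathcal M_\theta)-p_T(y_{1:T}\mid\mathcal M_{\theta'})|\le L_T\|\theta-\theta'\|$ for all $\theta,\theta'\in\Theta$, and let $\theta^\star\in\arg\max_{\theta\in\Theta}p_T(y_{1:T}\mid\mathcal M_\theta)$ be a maximum likelihood estimator. Then for any $\theta\in\Theta$ and any family $\{\alpha_t\}_{t\in\mathbb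 N}$ of parametric nudging transformations for $\mathcal M_\theta$, there exists a sequence of positive parameters $\gamma^\theta_{1:T}$ such that the nudged model $\mathcal M_\theta^\alpha$ constructed with the maps $\alpha_t(\cdot,\gamma_t^\theta)$ satisfies $$p_T(y_{1:T}\mid\mathcal M_\theta^\alpha)\in\Big[p_T(y_{1:T}\mid\mathcal M_{\theta^\star})-L_T\|\theta^\star-\theta\|,\ \ p_T(y_{1:T}\mid\mathcal M_{\theta^\star})+\Delta_T^\alpha(\theta)\Big],$$ where $\Delta_T^\alpha(\theta):=p_T(y_{1:T}\mid\mathcal M_\theta^\alpha)-p_T(y_{1:T}\mid\mathcal M_\theta)\ge0$.
   Context: State-space model: $\mathcal X\subseteq\mathbb R^{d_x}$ is a Borel set. A state-space model $\mathcal M=(\pi_0,K,g)$ consists of a probability measure $\pi_0$ on $\mathcal X$, Markov kernels $K=\{K_t\}_{t\ge1}$ from $\mathcal X$ to $\mathcal X$, and measurable likelihood functions $g_t:\mathcal X\to[0,\infty)$, $t\ge1$, associated with the fixed observations $y_t$. Notation: $\mu(f)=\int f\,d\mu$, $K_t\pi(dx)=\int K_t(x',dx)\,\pi(dx')$. Recursively for $t\ge1$: $\xi_t=K_t\pi_{t-1}$, $\pi_t(f)=\xi_t(fg_t)/\xi_t(g_t)$ (normalising constants positive); the Bayesian evidence is $p_T(y_{1:T}\mid\mathcal M)=\prod_{t=1}^T\xi_t(g_t)$. For $\mathcal M_\theta$, where $\Theta$ is a set of parameter vectors, all these objects carry the index $\theta$. Total variation: $\|\mu\|_{TV}=|\sup_{F\in\mathcal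 B(\mathcal X)}\mu(F)-\inf_{F\in\mathcal B(\mathcal X)}\mu(F)|$. Family of parametric nudging transformations for a model $\mathcal M$: maps $\alpha_t:\mathcal X\times[0,\infty)\to\mathcal X$, $t\in\mathbb N$ (Borel measurable in $x$), such that (1) $\alpha_t(x,\gamma)$ is continuous in $\gamma$ and $\lim_{\gamma\to0}\alpha_t(x,\gamma)=x$ for all $x\in\mathcal X$, $t\ge1$; (2) there are $\Gamma_t>0$ with $g_t(\alpha_t(x,\gamma))-g_t(x)\ge0$ for all $(x,\gamma)\in\mathcal X\times[0,\Gamma_t)$; (3) for every $t\ge1$ and $\gamma\in(0,\Gamma_t)$, $\int_{\mathcal X}[g_t(\alpha_t(x,\gamma))-g_t(x)]\,\xi_t(dx)>0$. Nudged model: given $\gamma_{1:T}$, $\mathcal M^\alpha=(\pi_0,K^\alpha,g)$ with $K_t^\alpha(x_{t-1},dx_t)=\int\delta_{\alpha_t(x_t',\gamma_t)}(dx_t)\,K_t(x_{t-1},dx_t')$; its evidence $p_T(y_{1:T}\mid\mathcal M^\alpha)=\prod_{t=1}^T\xi_t^\alpha(g_t)$ is defined through the same recursion with $K_t^\alpha$ in place of $K_t$ (a statement about it includes that the normalising constants needed are positive). *)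

theory Defs
  imports "HOL-Probability.Probability"
begin

record 'a ssm =
  init :: "'a measure"
  kern :: "nat \<Rightarrow> 'a \<Rightarrow> 'a measure"
  lik :: "nat \<Rightarrow> 'a \<Rightarrow> real"

definition state_space :: "'a::topological_space set \<Rightarrow> 'a measure"
  where "state_space X = restrict_space borel X"

text \<open>Time starts at \<open>t = 1\<close>; the values of \<open>kern\<close> and \<open>lik\<close> at \<open>0\<close> are never used.\<close>

primrec filtering :: "('a, 'z) ssm_scheme \<Rightarrow> nat \<Rightarrow> 'a measure"
  where
    "filtering M 0 = init M"
  | "filtering M (Suc t) =
      (let \<xi> = filtering M t \<bind> kern M (Suc t)
       in density \<xi> (\<lambda>x. ennreal (lik M (Suc t) x / (\<integral>y. lik M (Suc t) y \<partial>\<xi>))))"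

definition predictive :: "('a, 'z) ssm_scheme \<Rightarrow> nat \<Rightarrow> 'a measure"
  where "predictive M t = filtering M (t - 1) \<bind> kern M t"

definition norm_const :: "('a, 'z) ssm_scheme \<Rightarrow> nat \<Rightarrow> real"
  where "norm_const M t = (\<integral>x. lik M t x \<partial>predictive M t)"

definition evidence :: "('a, 'z) ssm_scheme \<Rightarrow> nat \<Rightarrow> real"
  where "evidence M T = (\<Prod>t=1..T. norm_const M t)"

text \<open>The last conjunct is what makes the filtering recursion well defined. A Bochner integral
  is \<open>0\<close> when the integrand is not integrable, so it also says that the likelihoods are
  integrable.\<close>

definition state_space_model ::
    "'a::topological_space set \<Rightarrow> ('a, 'z) ssm_scheme \<Rightarrow> bool"
  where "state_space_model X M \<longleftrightarrow>
    X \<in> sets borel \<and>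
    init M \<in> space (prob_algebra (state_space X)) \<and>
    (\<forall>t\<ge>1. kern M t \<in> state_space X \<rightarrow>\<^sub>M prob_algebra (state_space X)) \<and>
    (\<forall>t\<ge>1. lik M t \<in> borel_measurable (state_space X) \<and> (\<forall>x\<in>X. 0 \<le> lik M t x)) \<and>
    (\<forall>t\<ge>1. 0 < norm_const M t)"

text \<open>Total variation norm of a signed measure on \<open>X\<close>, given as a real-valued set function.\<close>

definition tv_norm :: "'a::topological_space set \<Rightarrow> ('a set \<Rightarrow> real) \<Rightarrow> real"
  where "tv_norm X \<mu> =
    \<bar>(SUP F\<in>sets (state_space X). \<mu> F) - (INF F\<in>sets (state_space X). \<mu> F)\<bar>"

definition tv_dist :: "'a::topological_space set \<Rightarrow> 'a measure \<Rightarrow> 'a measure \<Rightarrow> real"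
  where "tv_dist X \<mu> \<nu> = tv_norm X (\<lambda>F. measure \<mu> F - measure \<nu> F)"

definition tv_continuous_kernel ::
    "'a::real_normed_vector set \<Rightarrow> ('a \<Rightarrow> 'a measure) \<Rightarrow> bool"
  where "tv_continuous_kernel X k \<longleftrightarrow>
    (\<forall>x\<in>X. \<forall>\<epsilon>>0. \<exists>\<delta>>0. \<forall>x'\<in>X. norm (x - x') \<le> \<delta> \<longrightarrow> tv_dist X (k x) (k x') \<le> \<epsilon>)"

text \<open>A real supremum, hence meaningful only for functions bounded on a nonempty \<open>X\<close>.\<close>

definition sup_norm :: "'a set \<Rightarrow> ('a \<Rightarrow> real) \<Rightarrow> real"
  where "sup_norm X f = (SUP x\<in>X. \<bar>f x\<bar>)"

definition nudging_family ::
    "'a::real_normed_vector set \<Rightarrow> ('a, 'z) ssm_scheme \<Rightarrow> (nat \<Rightarrow> 'a \<Rightarrow> real \<Rightarrow> 'a) \<Rightarrow> bool"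
  where "nudging_family X M \<alpha> \<longleftrightarrow>
    (\<forall>t\<ge>1. \<forall>x\<in>X. \<forall>\<gamma>\<ge>0. \<alpha> t x \<gamma> \<in> X) \<and>
    (\<forall>t\<ge>1. \<forall>\<gamma>\<ge>0. (\<lambda>x. \<alpha> t x \<gamma>) \<in> state_space X \<rightarrow>\<^sub>M state_space X) \<and>
    (\<forall>t\<ge>1. \<forall>x\<in>X. continuous_on {0..} (\<alpha> t x) \<and> (\<alpha> t x \<longlongrightarrow> x) (at_right 0)) \<and>
    (\<exists>\<Gamma> :: nat \<Rightarrow> real. \<forall>t\<ge>1. 0 < \<Gamma> t \<and>
      (\<forall>x\<in>X. \<forall>\<gamma>\<in>{0..<\<Gamma> t}. 0 \<le> lik M t (\<alpha> t x \<gamma>) - lik M t x) \<and>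
      (\<forall>\<gamma>\<in>{0<..<\<Gamma> t}. 0 < (\<integral>x. (lik M t (\<alpha> t x \<gamma>) - lik M t x) \<partial>predictive M t)))"

definition nudged ::
    "'a::topological_space set \<Rightarrow> ('a, 'z) ssm_scheme \<Rightarrow> (nat \<Rightarrow> 'a \<Rightarrow> real \<Rightarrow> 'a) \<Rightarrow>
      (nat \<Rightarrow> real) \<Rightarrow> ('a, 'z) ssm_scheme"
  where "nudged X M \<alpha> \<gamma> =
    M\<lparr>kern := (\<lambda>t x. kern M t x \<bind> (\<lambda>x'. return (state_space X) (\<alpha> t x' (\<gamma> t))))\<rparr>"

end

theory Submission
  imports Defs
begin

text \<open>The evidence is the integral over \<open>\<pi>\<^sub>0\<close> of the likelihood of the observations given the initial
  state, and it can be evaluated by conditioning at any time. Nudging only at the last time \<open>T\<close>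
  strictly increases it, by condition (3). Nudging at an earlier time may decrease the likelihood
  of later observations, but that likelihood is a continuous function of the current state, because
  the kernels are continuous in total variation; by dominated convergence the loss is arbitrarily
  small for a small nudge. Hence \<open>\<gamma>\<^sub>T, \<gamma>\<^bsub>T-1\<^esub>, \<dots>, \<gamma>\<^sub>1\<close> can be chosen one after the other so that the
  evidence stays above its original value. The Lipschitz bound then gives the interval.\<close>

subsection \<open>Total variation and integrals\<close>

lemma space_state_space [simp]: "space (state_space X) = X"
  by (simp add: state_space_def space_restrict_space)

lemma prob_algebraD:
  assumes "\<mu> \<in> space (prob_algebra S)"
  shows "prob_space \<mu>" and "sets \<mu> = sets S" and "space \<mu> = space S"
  using assms by (auto simp: space_prob_algebra dest: sets_eq_imp_space_eq)

text \<open>Since the difference vanishes on the empty set, its supremum is at least 0 and its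
  infimum at most 0, so their distance dominates both the difference and its negative. The bound by
  1 keeps the real \<open>SUP\<close> and \<open>INF\<close> meaningful.\<close>

lemma abs_measure_diff_le_tv_dist:
  assumes \<mu>: "\<mu> \<in> space (prob_algebra (state_space X))"
    and \<nu>: "\<nu> \<in> space (prob_algebra (state_space X))"
    and F: "F \<in> sets (state_space X)"
  shows "\<bar>measure \<mu> F - measure \<nu> F\<bar> \<le> tv_dist X \<mu> \<nu>"
proof -
  interpret \<mu>: prob_space \<mu> using prob_algebraD(1)[OF \<mu>] .
  interpret \<nu>: prob_space \<nu> using prob_algebraD(1)[OF \<nu>] .
  define D where "D A = measure \<mu> A - measure \<nu> A" for A
  have bound: "\<bar>D A\<bar> \<le> 1" for A
    unfolding D_def using \<mu>.prob_le_1[of A] \<nu>.prob_le_1[of A] measure_nonneg[of \<mu> A] measure_nonneg[of \<nu> A]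
    by linarith
  have above: "bdd_above (D ` sets (state_space X))"
    by (rule bdd_aboveI2[where M=1]) (use bound in \<open>simp add: abs_le_iff\<close>)
  have below: "bdd_below (D ` sets (state_space X))"
    by (rule bdd_belowI2[where m="-1"]) (use bound in \<open>smt (verit)\<close>)
  have "D {} = 0" by (simp add: D_def)
  then have "D F \<le> (SUP A\<in>sets (state_space X). D A)" "0 \<le> (SUP A\<in>sets (state_space X). D A)"
    "(INF A\<in>sets (state_space X). D A) \<le> D F" "(INF A\<in>sets (state_space X). D A) \<le> 0"
    using cSUP_upper[OF F above] cSUP_upper[OF sets.empty_sets above]
      cINF_lower[OF below F] cINF_lower[OF below sets.empty_sets] by auto
  then show ?thesis
    unfolding tv_dist_def tv_norm_def D_def by linarith
qed

text \<open>A function with values between 0 and 1 is a limit of averages of indicators of its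
  superlevel sets. The measure of each such set changes by at most the total variation distance, and
  averaging adds no factor.\<close>

lemma abs_integral_diff_le_tv_dist:
  fixes f :: "'a::topological_space \<Rightarrow> real"
  assumes \<mu>: "\<mu> \<in> space (prob_algebra (state_space X))"
    and \<nu>: "\<nu> \<in> space (prob_algebra (state_space X))"
    and f [measurable]: "f \<in> borel_measurable (state_space X)"
    and f01: "\<And>x. x \<in> X \<Longrightarrow> 0 \<le> f x \<and> f x \<le> 1"
  shows "\<bar>(\<integral>x. f x \<partial>\<mu>) - (\<integral>x. f x \<partial>\<nu>)\<bar> \<le> tv_dist X \<mu> \<nu>"
proof -
  define A where "A n i = {x \<in> space (state_space X). real i / real n \<le> f x}" for n i :: nat
  have A [measurable]: "A n i \<in> sets (state_space X)" for n i
    unfolding A_def by measurable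
  \<comment> \<open>Discretised layer-cake formula; \<open>s n\<close> is \<open>f\<close> rounded down to a multiple of \<open>1/n\<close>.\<close>
  define s where "s n x = (\<Sum>i=1..n. indicator (A n i) x) / real n" for n x
  have s_meas [measurable]: "s n \<in> borel_measurable (state_space X)" for n
    unfolding s_def by measurable
  have s_close: "\<bar>f x - s n x\<bar> \<le> 1 / real n" if x: "x \<in> X" and n: "0 < n" for x n
  proof -
    \<comment> \<open>\<open>m\<close> counts the levels \<open>i / n\<close> with \<open>i\<close>
      at least 1 that do not exceed \<open>f x\<close>. As \<open>f x \<le> 1\<close>, there are at
      most \<open>n\<close> of them, so the sum up to \<open>n\<close> misses none.\<close>
    define m where "m = nat \<lfloor>real n * f x\<rfloor>"
    have nf: "0 \<le> real n * f x" "real n * f x \<le> real n"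
      using f01[OF x] n by (auto simp: mult_le_cancel_left1)
    have m: "real m \<le> real n * f x" "real n * f x < real m + 1"
      unfolding m_def using nf by linarith+
    have "(\<Sum>i=1..n. indicator (A n i) x) = (\<Sum>i=1..n. if i \<le> m then 1 else (0::real))"
    proof (rule sum.cong[OF refl])
      fix i :: nat
      have "real i \<le> real n * f x \<longleftrightarrow> i \<le> m"
        using m by linarith
      then show "indicator (A n i) x = (if i \<le> m then 1 else (0::real))"
        using x n by (simp add: A_def indicator_def field_simps)
    qed
    also have "\<dots> = real (card {i \<in> {1..n}. i \<le> m})"
      by (simp add: sum.If_cases Int_def)
    also have "{i \<in> {1..n}. i \<le> m} = {1..m}"
      using m nf by auto
    finally have "s n x = real m / real n"
      by (simp add: s_def)
    then show ?thesis
      using m n by (simp add: abs_le_iff field_simps)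
  qed
  have s_int: "(\<integral>x. s n x \<partial>\<rho>) = (\<Sum>i=1..n. measure \<rho> (A n i)) / real n"
      and s_approx: "0 < n \<Longrightarrow> \<bar>(\<integral>x. f x \<partial>\<rho>) - (\<integral>x. s n x \<partial>\<rho>)\<bar> \<le> 1 / real n"
    if \<rho>: "\<rho> \<in> space (prob_algebra (state_space X))" for \<rho> n
  proof -
    note [measurable_cong] = prob_algebraD(2)[OF \<rho>]
    have sp: "space \<rho> = X" using prob_algebraD(3)[OF \<rho>] by simp
    interpret prob_space \<rho> using prob_algebraD(1)[OF \<rho>] .
    have A': "A n i \<in> sets \<rho>" for i by measurable
    then show "(\<integral>x. s n x \<partial>\<rho>) = (\<Sum>i=1..n. measure \<rho> (A n i)) / real n"
      unfolding s_def by (simp add: emeasure_eq_measure sets.Int_space_eq2)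
    show "\<bar>(\<integral>x. f x \<partial>\<rho>) - (\<integral>x. s n x \<partial>\<rho>)\<bar> \<le> 1 / real n" if n: "0 < n"
    proof -
      have close: "AE x in \<rho>. \<bar>f x - s n x\<bar> \<le> 1 / real n"
        by (rule AE_I2) (use s_close n sp in auto)
      have f_int: "integrable \<rho> f"
        by (rule integrable_const_bound[where B=1]) (use f01 sp in \<open>auto intro!: AE_I2\<close>)
      have d_int: "integrable \<rho> (\<lambda>x. f x - s n x)"
        by (rule integrable_const_bound[where B="1 / real n"]) (use close in auto)
      have s_integrable: "integrable \<rho> (s n)"
        using Bochner_Integration.integrable_diff[OF f_int d_int] by simp
      have "\<bar>\<integral>x. f x - s n x \<partial>\<rho>\<bar> \<le> (\<integral>x. \<bar>f x - s n x\<bar> \<partial>\<rho>)"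
        by (rule integral_abs_bound)
      also have "\<dots> \<le> (\<integral>x. 1 / real n \<partial>\<rho>)"
        by (intro integral_mono_AE integrable_abs d_int close) simp
      also have "\<dots> = 1 / real n" by (simp add: prob_space)
      finally show ?thesis by (simp add: f_int s_integrable)
    qed
  qed
  \<comment> \<open>Each of the two measures contributes one rounding error
    \<open>1 / n\<close>.\<close>
  have "\<bar>(\<integral>x. f x \<partial>\<mu>) - (\<integral>x. f x \<partial>\<nu>)\<bar> \<le> tv_dist X \<mu> \<nu> + 2 / real n" if n: "0 < n" for n
  proof -
    have "\<bar>(\<integral>x. s n x \<partial>\<mu>) - (\<integral>x. s n x \<partial>\<nu>)\<bar>
        = \<bar>\<Sum>i=1..n. measure \<mu> (A n i) - measure \<nu> (A n i)\<bar> / real n"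
      by (simp add: s_int[OF \<mu>] s_int[OF \<nu>] sum_subtractf flip: diff_divide_distrib)
    also have "\<dots> \<le> (\<Sum>i=1..n. tv_dist X \<mu> \<nu>) / real n"
      by (intro divide_right_mono order.trans[OF sum_abs] sum_mono
            abs_measure_diff_le_tv_dist[OF \<mu> \<nu>] A) simp
    also have "\<dots> = tv_dist X \<mu> \<nu>" using n by simp
    finally show ?thesis
      using s_approx[OF \<mu> n] s_approx[OF \<nu> n] by linarith
  qed
  then have *: "\<bar>(\<integral>x. f x \<partial>\<mu>) - (\<integral>x. f x \<partial>\<nu>)\<bar> \<le> tv_dist X \<mu> \<nu> + 2 / real (Suc n)" for n
    by blast
  have "(\<lambda>n. tv_dist X \<mu> \<nu> + 2 / real (Suc n)) \<longlonglongrightarrow> tv_dist X \<mu> \<nu> + 0"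
    by (intro tendsto_add tendsto_const LIMSEQ_Suc[OF lim_const_over_n])
  then show ?thesis
    using LIMSEQ_le_const[of _ "tv_dist X \<mu> \<nu>"] * by auto
qed

text \<open>Covers a non-integrable \<open>f\<close> as well: its Bochner integral is 0, and
  \<open>B\<close> is nonnegative because a probability space has a point.\<close>

lemma abs_integral_le_bound:
  fixes f :: "'a \<Rightarrow> real"
  assumes "prob_space \<mu>" and "\<And>x. x \<in> space \<mu> \<Longrightarrow> \<bar>f x\<bar> \<le> B"
  shows "\<bar>\<integral>x. f x \<partial>\<mu>\<bar> \<le> B"
proof -
  interpret prob_space \<mu> by fact
  have "0 \<le> B" using assms(2) not_empty by fastforce
  show ?thesis
  proof (cases "integrable \<mu> f")
    case True
    have "\<bar>\<integral>x. f x \<partial>\<mu>\<bar> \<le> (\<integral>x. \<bar>f x\<bar> \<partial>\<mu>)" by (rule integral_abs_bound)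
    also have "\<dots> \<le> (\<integral>x. B \<partial>\<mu>)"
      by (intro integral_mono integrable_abs True assms(2)) simp
    finally show ?thesis by (simp add: prob_space)
  qed (use \<open>0 \<le> B\<close> in \<open>simp add: not_integrable_integral_eq\<close>)
qed

section \<open>Bounded functions and their integrability\<close>

lemma bounded_real_image: "bounded (f ` X) \<longleftrightarrow> (\<exists>B>0. \<forall>x\<in>X. \<bar>f x :: real\<bar> \<le> B)"
  by (simp add: bounded_pos)

lemma bounded_image_mult:
  fixes f g :: "'a \<Rightarrow> real"
  assumes "bounded (f ` X)" and "bounded (g ` X)"
  shows "bounded ((\<lambda>x. f x * g x) ` X)"
proof -
  obtain B C where "B > 0" "\<forall>x\<in>X. \<bar>f x\<bar> \<le> B" "C > 0" "\<forall>x\<in>X. \<bar>g x\<bar> \<le> C"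
    using assms unfolding bounded_real_image by blast
  then show ?thesis
    unfolding bounded_real_image by (intro exI[of _ "B * C"]) (auto simp: abs_mult intro!: mult_mono)
qed

text \<open>Stated for subprobabilities because a vanishing normalising constant turns the filter
  into the null measure.\<close>

lemma integrable_bounded_state_space:
  fixes f :: "'a::topological_space \<Rightarrow> real"
  assumes \<mu>: "\<mu> \<in> space (subprob_algebra (state_space X))"
    and f: "f \<in> borel_measurable (state_space X)" and bdd: "bounded (f ` X)"
  shows "integrable \<mu> f"
proof -
  have s: "sets \<mu> = sets (state_space X)" and "subprob_space \<mu>"
    using \<mu> by (auto simp: space_subprob_algebra)
  then interpret subprob_space \<mu> by blast
  have [simp]: "space \<mu> = X" using sets_eq_imp_space_eq[OF s] by simp
  obtain B where "\<forall>x\<in>X. \<bar>f x\<bar> \<le> B" using bdd unfolding bounded_real_image by blast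
  then show ?thesis
    by (intro integrable_const_bound[of _ B] AE_I2) (use f s in \<open>auto cong: measurable_cong_sets\<close>)
qed

lemma prob_algebra_imp_subprob_algebra:
  "\<mu> \<in> space (prob_algebra S) \<Longrightarrow> \<mu> \<in> space (subprob_algebra S)"
  by (auto simp: space_prob_algebra space_subprob_algebra prob_space_imp_subprob_space)

text \<open>A strong Feller property. The affine map in \<open>h\<close> brings the values of
  \<open>f\<close> between 0 and 1, where total variation controls integrals; undoing it costs a
  factor \<open>2 * B\<close>.\<close>

lemma continuous_on_tv_continuous_kernel:
  fixes f :: "'a::real_normed_vector \<Rightarrow> real"
  assumes k: "k \<in> state_space X \<rightarrow>\<^sub>M prob_algebra (state_space X)"
    and tv: "tv_continuous_kernel X k"
    and f [measurable]: "f \<in> borel_measurable (state_space X)" and bdd: "bounded (f ` X)"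
  shows "continuous_on X (\<lambda>x. \<integral>y. f y \<partial>k x)"
proof -
  obtain B where B: "B > 0" "\<And>x. x \<in> X \<Longrightarrow> \<bar>f x\<bar> \<le> B"
    using bdd unfolding bounded_real_image by blast
  define h where "h x = (f x + B) / (2 * B)" for x
  have h_meas: "h \<in> borel_measurable (state_space X)"
    unfolding h_def by measurable
  have h01: "0 \<le> h x \<and> h x \<le> 1" if "x \<in> X" for x
    using B(1) B(2)[OF that] by (auto simp: h_def abs_le_iff field_simps)
  have kx: "k x \<in> space (prob_algebra (state_space X))" if "x \<in> X" for x
    using measurable_space[OF k] that by simp
  have h_int: "(\<integral>y. f y \<partial>k x) = 2 * B * (\<integral>y. h y \<partial>k x) - B" if "x \<in> X" for x
  proof -
    interpret prob_space "k x" using prob_algebraD(1)[OF kx[OF that]] .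
    have "integrable (k x) f"
      using integrable_bounded_state_space[OF prob_algebra_imp_subprob_algebra[OF kx[OF that]] f bdd] .
    then show ?thesis
      using B(1) by (simp add: h_def prob_space field_simps)
  qed
  have diff: "\<bar>(\<integral>y. f y \<partial>k x) - (\<integral>y. f y \<partial>k x')\<bar> \<le> 2 * B * tv_dist X (k x) (k x')"
    if "x \<in> X" "x' \<in> X" for x x'
  proof -
    have "\<bar>(\<integral>y. f y \<partial>k x) - (\<integral>y. f y \<partial>k x')\<bar> = 2 * B * \<bar>(\<integral>y. h y \<partial>k x) - (\<integral>y. h y \<partial>k x')\<bar>"
      using B(1) by (simp add: h_int that abs_mult flip: right_diff_distrib)
    then show ?thesis
      using abs_integral_diff_le_tv_dist[OF kx[OF that(1)] kx[OF that(2)] h_meas h01] B(1)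
      by simp
  qed
  show ?thesis
    unfolding continuous_on_iff
  proof (intro ballI allI impI)
    fix x and e :: real
    assume x: "x \<in> X" and e: "0 < e"
    \<comment> \<open>After the factor \<open>2 * B\<close> this leaves \<open>e / 2\<close>, hence
      the strict inequality that continuity asks for.\<close>
    then obtain d where d: "d > 0"
      "\<And>x'. x' \<in> X \<Longrightarrow> norm (x - x') \<le> d \<Longrightarrow> tv_dist X (k x) (k x') \<le> e / (4 * B)"
      using tv B(1) unfolding tv_continuous_kernel_def by (metis divide_pos_pos mult_pos_pos zero_less_numeral)
    show "\<exists>d>0. \<forall>x'\<in>X. dist x' x < d \<longrightarrow> dist (\<integral>y. f y \<partial>k x') (\<integral>y. f y \<partial>k x) < e"
    proof (intro exI conjI ballI impI)
      fix x' assume x': "x' \<in> X" "dist x' x < d"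
      then have "tv_dist X (k x) (k x') \<le> e / (4 * B)"
        using d by (simp add: dist_norm norm_minus_commute)
      then have "2 * B * tv_dist X (k x) (k x') \<le> 2 * B * (e / (4 * B))"
        using B(1) by (intro mult_left_mono) auto
      also have "\<dots> < e" using B(1) e by simp
      finally show "dist (\<integral>y. f y \<partial>k x') (\<integral>y. f y \<partial>k x) < e"
        using diff[OF x x'(1)] by (simp add: dist_real_def abs_minus_commute)
    qed (fact d(1))
  qed
qed

subsection \<open>Evidence through the backward likelihood\<close>

text \<open>\<open>backward_lik M n t x\<close> is the likelihood of \<open>y\<^bsub>t+1\<^esub>, \<dots>, y\<^bsub>t+n\<^esub>\<close> given \<open>x\<^sub>t = x\<close>.\<close>

primrec backward_lik :: "('a, 'z) ssm_scheme \<Rightarrow> nat \<Rightarrow> nat \<Rightarrow> 'a \<Rightarrow> real"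
  where
    "backward_lik M 0 = (\<lambda>t x. 1)"
  | "backward_lik M (Suc n) =
      (\<lambda>t x. \<integral>y. lik M (Suc t) y * backward_lik M n (Suc t) y \<partial>kern M (Suc t) x)"

lemma evidence_Suc: "evidence M (Suc t) = evidence M t * norm_const M (Suc t)"
  by (simp add: evidence_def)

text \<open>Positivity of the normalising constants is left out so that nudged models are instances
  before their positivity is known. The lemmas below therefore allow filters of mass 0.\<close>

locale bounded_ssm =
  fixes X :: "'a::topological_space set" and M :: "('a, 'z) ssm_scheme"
  assumes init: "init M \<in> space (prob_algebra (state_space X))"
    and kern: "1 \<le> t \<Longrightarrow> kern M t \<in> state_space X \<rightarrow>\<^sub>M prob_algebra (state_space X)"
    and lik_measurable: "1 \<le> t \<Longrightarrow> lik M t \<in> borel_measurable (state_space X)"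
    and lik_nonneg: "1 \<le> t \<Longrightarrow> x \<in> X \<Longrightarrow> 0 \<le> lik M t x"
    and lik_bounded: "1 \<le> t \<Longrightarrow> bounded (lik M t ` X)"
begin

lemma kern_prob: "1 \<le> t \<Longrightarrow> x \<in> X \<Longrightarrow> kern M t x \<in> space (prob_algebra (state_space X))"
  using measurable_space[OF kern] by simp

lemma filtering_subprob: "filtering M t \<in> space (subprob_algebra (state_space X))"
  and predictive_subprob: "predictive M (Suc t) \<in> space (subprob_algebra (state_space X))"
proof -
  have bind: "\<mu> \<bind> kern M (Suc t) \<in> space (subprob_algebra (state_space X))"
    if "\<mu> \<in> space (subprob_algebra (state_space X))" for \<mu> t
  proof -
    from that have s: "sets \<mu> = sets (state_space X)" and "subprob_space \<mu>"
      by (auto simp: space_subprob_algebra)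
    then interpret subprob_space \<mu> by blast
    show ?thesis
      by (rule bind_in_space)
        (use measurable_prob_algebraD[OF kern] s in \<open>simp cong: measurable_cong_sets\<close>)
  qed
  show *: "filtering M t \<in> space (subprob_algebra (state_space X))" for t
  proof (induction t)
    case 0
    then show ?case using init by (simp add: prob_algebra_imp_subprob_algebra)
  next
    case (Suc t)
    define \<xi> where "\<xi> = filtering M t \<bind> kern M (Suc t)"
    define c where "c = (\<integral>y. lik M (Suc t) y \<partial>\<xi>)"
    have \<xi>: "\<xi> \<in> space (subprob_algebra (state_space X))"
      unfolding \<xi>_def by (rule bind[OF Suc.IH])
    then have s: "sets \<xi> = sets (state_space X)" and "subprob_space \<xi>"
      by (auto simp: space_subprob_algebra)
    interpret subprob_space \<xi> by fact
    have sp: "space \<xi> = X" using sets_eq_imp_space_eq[OF s] by simp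
    have m: "lik M (Suc t) \<in> borel_measurable \<xi>"
      using lik_measurable s by (simp cong: measurable_cong_sets)
    have i: "integrable \<xi> (lik M (Suc t))"
      by (intro integrable_bounded_state_space[OF \<xi>] lik_measurable lik_bounded) simp_all
    have c0: "0 \<le> c"
      unfolding c_def by (rule integral_nonneg_AE, rule AE_I2) (use lik_nonneg sp in simp)
    define \<pi> where "\<pi> = density \<xi> (\<lambda>x. ennreal (lik M (Suc t) x / c))"
    have "emeasure \<pi> (space \<pi>) = (\<integral>\<^sup>+x. ennreal (lik M (Suc t) x / c) \<partial>\<xi>)"
      unfolding \<pi>_def using m by (subst emeasure_density) (auto intro!: nn_integral_cong)
    also have "\<dots> = ennreal (\<integral>x. lik M (Suc t) x / c \<partial>\<xi>)"
      by (rule nn_integral_eq_integral) (use i c0 lik_nonneg sp in \<open>auto intro!: AE_I2\<close>)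
    \<comment> \<open>\<open>c / c\<close> is 1 if \<open>c\<close> is positive and 0 if
      \<open>c = 0\<close>, which is why only a subprobability is claimed.\<close>
    also have "\<dots> = ennreal (c / c)"
      by (simp add: c_def)
    also have "\<dots> \<le> 1" by simp
    finally have "subprob_space \<pi>"
      by (rule subprob_spaceI) (use subprob_not_empty in \<open>simp add: \<pi>_def\<close>)
    then show ?case
      using s by (simp add: space_subprob_algebra \<pi>_def \<xi>_def c_def Let_def)
  qed
  show "predictive M (Suc t) \<in> space (subprob_algebra (state_space X))"
    unfolding predictive_def using bind[OF *] by simp
qed

lemma filtering_space: "space (filtering M t) = X"
  using filtering_subprob[of t] by (auto simp: space_subprob_algebra dest: sets_eq_imp_space_eq)

text \<open>Duality between pushing a measure forward through the kernel and integrating a test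
  function against it. It exchanges the forward recursion of the filter for the backward recursion
  of the likelihood.\<close>

lemma integral_predictive:
  fixes f :: "'a \<Rightarrow> real"
  assumes f: "f \<in> borel_measurable (state_space X)" and bdd: "bounded (f ` X)"
  shows "(\<integral>x. f x \<partial>predictive M (Suc t)) = (\<integral>x. (\<integral>y. f y \<partial>kern M (Suc t) x) \<partial>filtering M t)"
proof -
  obtain B where B: "\<forall>x\<in>X. \<bar>f x\<bar> \<le> B" using bdd unfolding bounded_real_image by blast
  have s: "sets (filtering M t) = sets (state_space X)" and "subprob_space (filtering M t)"
    using filtering_subprob by (auto simp: space_subprob_algebra)
  interpret subprob_space "filtering M t" by fact
  note sp = filtering_space[of t]
  show ?thesis
    unfolding predictive_def diff_Suc_1
  proof (rule integral_bind[OF f, where B'=1 and B=B])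
    show "kern M (Suc t) \<in> filtering M t \<rightarrow>\<^sub>M subprob_algebra (state_space X)"
      using measurable_prob_algebraD[OF kern] s by (simp cong: measurable_cong_sets)
    show "AE x in filtering M t. emeasure (kern M (Suc t) x) (space (kern M (Suc t) x)) \<le> ennreal 1"
      by (rule AE_I2) (use prob_algebraD(1)[OF kern_prob] sp in \<open>auto simp: prob_space.emeasure_space_1\<close>)
  qed (use B in \<open>auto intro: finite_measure_axioms\<close>)
qed

text \<open>If the normalising constant vanishes, the filter is the null measure because of \<open>x / 0 = 0\<close>,
  and both sides are \<open>0\<close>.\<close>

lemma evidence_integral_filtering_Suc:
  fixes f :: "'a \<Rightarrow> real"
  assumes f: "f \<in> borel_measurable (state_space X)" and bdd: "bounded (f ` X)"
  shows "evidence M (Suc t) * (\<integral>x. f x \<partial>filtering M (Suc t))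
    = evidence M t * (\<integral>x. lik M (Suc t) x * f x \<partial>predictive M (Suc t))"
proof -
  define \<xi> where "\<xi> = predictive M (Suc t)"
  define c where "c = norm_const M (Suc t)"
  have c: "c = (\<integral>x. lik M (Suc t) x \<partial>\<xi>)" by (simp add: c_def norm_const_def \<xi>_def)
  have \<xi>: "\<xi> \<in> space (subprob_algebra (state_space X))"
    unfolding \<xi>_def by (rule predictive_subprob)
  then have s: "sets \<xi> = sets (state_space X)" by (auto simp: space_subprob_algebra)
  have sp: "space \<xi> = X" using sets_eq_imp_space_eq[OF s] by simp
  have m: "lik M (Suc t) \<in> borel_measurable \<xi>" "f \<in> borel_measurable \<xi>"
    using lik_measurable f s by (simp_all cong: measurable_cong_sets)
  have i: "integrable \<xi> (lik M (Suc t))"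
    by (intro integrable_bounded_state_space[OF \<xi>] lik_measurable lik_bounded) simp_all
  have nn: "AE x in \<xi>. 0 \<le> lik M (Suc t) x"
    by (rule AE_I2) (use lik_nonneg sp in simp)
  have c0: "0 \<le> c" unfolding c by (rule integral_nonneg_AE[OF nn])
  have "filtering M (Suc t) = density \<xi> (\<lambda>x. ennreal (lik M (Suc t) x / c))"
    by (simp add: c \<xi>_def predictive_def Let_def)
  moreover have "AE x in \<xi>. 0 \<le> lik M (Suc t) x / c"
    using nn by eventually_elim (use c0 in simp)
  ultimately have *: "(\<integral>x. f x \<partial>filtering M (Suc t)) = (\<integral>x. lik M (Suc t) x * f x \<partial>\<xi>) / c"
    using m by (simp add: integral_density del: filtering.simps)
  show ?thesis
  proof (cases "c = 0")
    case True
    then have "AE x in \<xi>. lik M (Suc t) x = 0"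
      using integral_nonneg_eq_0_iff_AE[OF i nn] c by simp
    then have "(\<integral>x. lik M (Suc t) x * f x \<partial>\<xi>) = 0"
      by (intro integral_eq_zero_AE) auto
    then show ?thesis unfolding * by (simp add: \<xi>_def)
  next
    case False
    then show ?thesis unfolding * by (simp add: evidence_Suc flip: \<xi>_def c_def)
  qed
qed

section \<open>Measurability and boundedness of the backward likelihood\<close>

lemma integral_kern_measurable:
  fixes f :: "'a \<Rightarrow> real"
  assumes "1 \<le> t" and "f \<in> borel_measurable (state_space X)"
  shows "(\<lambda>x. \<integral>y. f y \<partial>kern M t x) \<in> borel_measurable (state_space X)"
  using measurable_compose[OF measurable_prob_algebraD[OF kern] integral_measurable_subprob_algebra] assms
  by blast

lemma integral_kern_bounded:
  fixes f :: "'a \<Rightarrow> real"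
  assumes "1 \<le> t" and "bounded (f ` X)"
  shows "bounded ((\<lambda>x. \<integral>y. f y \<partial>kern M t x) ` X)"
proof -
  obtain B where B: "B > 0" "\<forall>x\<in>X. \<bar>f x\<bar> \<le> B" using assms unfolding bounded_real_image by blast
  have "\<bar>\<integral>y. f y \<partial>kern M t x\<bar> \<le> B" if "x \<in> X" for x
    using abs_integral_le_bound prob_algebraD(1,3)[OF kern_prob[OF assms(1) that]] B by fastforce
  then show ?thesis unfolding bounded_real_image using B by blast
qed

lemma backward_lik_measurable: "backward_lik M n t \<in> borel_measurable (state_space X)"
  by (induction n arbitrary: t)
    (simp_all add: integral_kern_measurable borel_measurable_times lik_measurable)

lemma backward_lik_bounded: "bounded (backward_lik M n t ` X)"
proof (induction n arbitrary: t)
  case 0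
  show ?case unfolding bounded_real_image by (intro exI[of _ 1]) simp
qed (simp add: integral_kern_bounded bounded_image_mult lik_bounded)

lemma lik_backward_lik_measurable:
  "(\<lambda>x. lik M (Suc t) x * backward_lik M n (Suc t) x) \<in> borel_measurable (state_space X)"
  by (intro borel_measurable_times lik_measurable backward_lik_measurable) simp

lemma lik_backward_lik_bounded:
  "bounded ((\<lambda>x. lik M (Suc t) x * backward_lik M n (Suc t) x) ` X)"
  by (intro bounded_image_mult lik_bounded backward_lik_bounded) simp

text \<open>With the final time fixed, \<open>evidence M t\<close> times the filtered backward
  likelihood does not depend on \<open>t\<close>: each step only moves one update and one prediction
  from the measure to the integrand.\<close>

lemma evidence_eq_integral_backward_lik: "evidence M n = (\<integral>x. backward_lik M n 0 x \<partial>init M)"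
proof -
  \<comment> \<open>At the final time the backward likelihood is 1, so its integral is the mass of
    the filter, which may be 0.\<close>
  have "evidence M (t + n) * measure (filtering M (t + n)) X
      = evidence M t * (\<integral>x. backward_lik M n t x \<partial>filtering M t)" for t
  proof (induction n arbitrary: t)
    case 0
    show ?case by (simp add: filtering_space)
  next
    case (Suc n)
    show ?case
      using Suc.IH[of "Suc t"]
      by (simp add: evidence_integral_filtering_Suc[OF backward_lik_measurable backward_lik_bounded]
          integral_predictive[OF lik_backward_lik_measurable lik_backward_lik_bounded] del: filtering.simps)
  qed
  from this[of 0] have *: "evidence M n * measure (filtering M n) X
      = (\<integral>x. backward_lik M n 0 x \<partial>init M)"
    by (simp add: evidence_def)
  \<comment> \<open>The mass factor drops out even if the evidence is 0: for a positive time this is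
    the one-step identity with the test function 1.\<close>
  have "evidence M n * measure (filtering M n) X = evidence M n"
  proof (cases n)
    case 0
    then show ?thesis
      using prob_algebraD[OF init] prob_space.prob_space[of "init M"] by (simp add: evidence_def)
  next
    case (Suc t)
    have "evidence M (Suc t) * (\<integral>x. 1 \<partial>filtering M (Suc t)) = evidence M (Suc t)"
      using evidence_integral_filtering_Suc[of "\<lambda>_. 1" t]
      by (simp add: bounded_real_image[of "\<lambda>_. 1"] evidence_Suc norm_const_def
          exI[of _ "1::real"] del: filtering.simps lebesgue_integral_const)
    then show ?thesis unfolding Suc by (simp add: filtering_space del: filtering.simps)
  qed
  with * show ?thesis by simp
qed

lemma norm_const_nonneg: "1 \<le> t \<Longrightarrow> 0 \<le> norm_const M t"
proof -
  assume "1 \<le> t"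
  then obtain u where t: "t = Suc u" by (cases t) auto
  have "space (predictive M t) = X"
    using predictive_subprob[of u] t by (auto simp: space_subprob_algebra dest: sets_eq_imp_space_eq)
  then show ?thesis
    unfolding norm_const_def by (intro integral_nonneg_AE AE_I2) (use lik_nonneg \<open>1 \<le> t\<close> in simp)
qed

end

subsection \<open>Choosing the nudging parameters\<close>

lemma lik_nudged [simp]: "lik (nudged X M \<alpha> \<gamma>) = lik M"
  and init_nudged [simp]: "init (nudged X M \<alpha> \<gamma>) = init M"
  and kern_nudged: "kern (nudged X M \<alpha> \<gamma>) t x =
    kern M t x \<bind> (\<lambda>y. return (state_space X) (\<alpha> t y (\<gamma> t)))"
  by (simp_all add: nudged_def)

text \<open>Allows the parameters to be chosen from the last to the first: altering the current one
  does not disturb what the later ones have achieved.\<close>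

lemma backward_lik_nudged_cong:
  assumes "\<And>s. t < s \<Longrightarrow> \<gamma> s = \<gamma>' s"
  shows "backward_lik (nudged X M \<alpha> \<gamma>) n t = backward_lik (nudged X M \<alpha> \<gamma>') n t"
  using assms
proof (induction n arbitrary: t)
  case (Suc n)
  have "backward_lik (nudged X M \<alpha> \<gamma>) n (Suc t) = backward_lik (nudged X M \<alpha> \<gamma>') n (Suc t)"
    by (rule Suc.IH) (use Suc.prems in simp)
  then show ?case using Suc.prems[of "Suc t"] by (simp add: kern_nudged)
qed simp

context bounded_ssm
begin

text \<open>Makes the evidence formula available for the nudged model. The likelihoods stay the
  same, and the kernel is composed with a deterministic one.\<close>

lemma bounded_ssm_nudged:
  assumes "\<And>t. 1 \<le> t \<Longrightarrow> (\<lambda>x. \<alpha> t x (\<gamma> t)) \<in> state_space X \<rightarrow>\<^sub>M state_space X"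
  shows "bounded_ssm X (nudged X M \<alpha> \<gamma>)"
proof
  fix t :: nat assume t: "1 \<le> t"
  have "(\<lambda>x. kern M t x \<bind> (\<lambda>y. return (state_space X) (\<alpha> t y (\<gamma> t))))
      \<in> state_space X \<rightarrow>\<^sub>M prob_algebra (state_space X)"
    by (rule measurable_bind_prob_space[OF kern[OF t]
          measurable_compose[OF assms[OF t] measurable_return_prob_space]])
  then show "kern (nudged X M \<alpha> \<gamma>) t \<in> state_space X \<rightarrow>\<^sub>M prob_algebra (state_space X)"
    by (simp add: kern_nudged[abs_def])
qed (use init lik_measurable lik_nonneg lik_bounded in auto)

text \<open>The nudged kernel is the image of the original one under the nudging map. The change of
  variables moves the nudge into the integrand and keeps the original kernel, whose continuity is
  known.\<close>

lemma integral_kern_nudged: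
  fixes f :: "'a \<Rightarrow> real"
  assumes \<alpha>: "(\<lambda>y. \<alpha> t y (\<gamma> t)) \<in> state_space X \<rightarrow>\<^sub>M state_space X"
    and "1 \<le> t" "x \<in> X" and f: "f \<in> borel_measurable (state_space X)"
  shows "(\<integral>y. f y \<partial>kern (nudged X M \<alpha> \<gamma>) t x) = (\<integral>y. f (\<alpha> t y (\<gamma> t)) \<partial>kern M t x)"
proof -
  note k = prob_algebraD[OF kern_prob[OF \<open>1 \<le> t\<close> \<open>x \<in> X\<close>]]
  have m: "(\<lambda>y. \<alpha> t y (\<gamma> t)) \<in> kern M t x \<rightarrow>\<^sub>M state_space X"
    using \<alpha> k(2) by (simp cong: measurable_cong_sets)
  have "space (kern M t x) \<noteq> {}" using k(1) prob_space.not_empty by blast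
  then show ?thesis
    using m f by (simp add: kern_nudged bind_return_distr' integral_distr)
qed

end

text \<open>Interpolates between the models by hybrids that run the original filter up to time
  \<open>t\<close> and nudge only afterwards. As \<open>t\<close> is lowered to 0, the strict
  inequality provides the slack that absorbs the loss caused by each new nudge.\<close>

lemma exists_nudging_increasing_evidence:
  fixes X :: "'a::real_normed_vector set" and M :: "('a, 'z) ssm_scheme"
  assumes "bounded_ssm X M"
    and pos: "\<And>t. 1 \<le> t \<Longrightarrow> 0 < norm_const M t"
    and lik_cont: "\<And>t. 1 \<le> t \<Longrightarrow> continuous_on X (lik M t)"
    and tv: "\<And>t. 1 \<le> t \<Longrightarrow> tv_continuous_kernel X (kern M t)"
    and nudging: "nudging_family X M \<alpha>"
    and T: "1 \<le> T"
  obtains \<gamma> where "\<And>t. 0 < \<gamma> t" and "evidence M T < evidence (nudged X M \<alpha> \<gamma>) T"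
proof -
  interpret bounded_ssm X M by fact
  let ?N = "nudged X M \<alpha>"
  have \<alpha>_in: "\<alpha> t x c \<in> X" if "1 \<le> t" "x \<in> X" "0 \<le> c" for t x c
    using nudging that by (simp add: nudging_family_def)
  have \<alpha>_meas: "(\<lambda>x. \<alpha> t x c) \<in> state_space X \<rightarrow>\<^sub>M state_space X" if "1 \<le> t" "0 \<le> c" for t c
    using nudging that by (simp add: nudging_family_def)
  have \<alpha>_lim: "(\<alpha> t x \<longlongrightarrow> x) (at_right 0)" if "1 \<le> t" "x \<in> X" for t x
    using nudging that by (simp add: nudging_family_def)
  \<comment> \<open>Positivity is asked at every index, also beyond \<open>T\<close>, because the
    locale constrains the model at all times.\<close>
  have N: "bounded_ssm X (?N \<gamma>)" if "\<And>s. 0 < \<gamma> s" for \<gamma>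
    by (rule bounded_ssm_nudged) (simp add: \<alpha>_meas less_imp_le that)
  have comp_bounded: "bounded ((\<lambda>x. f (\<alpha> t x c)) ` X)"
    if "1 \<le> t" "0 \<le> c" "bounded (f ` X)" for f :: "'a \<Rightarrow> real" and t c
    using that(3) by (rule bounded_subset) (use \<alpha>_in that in auto)
  \<comment> \<open>The nudging maps are only measurable in the state, so continuity comes from the
    original kernel, applied to a bounded measurable integrand that contains the nudge.\<close>
  have cont: "continuous_on X (backward_lik (?N \<gamma>) n t)" if \<gamma>: "\<And>s. 0 < \<gamma> s" for \<gamma> n t
  proof (cases n)
    case (Suc m)
    interpret N: bounded_ssm X "?N \<gamma>" by (rule N[OF \<gamma>])
    let ?f = "\<lambda>y. lik M (Suc t) y * backward_lik (?N \<gamma>) m (Suc t) y"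
    note f_meas = N.lik_backward_lik_measurable[of t m, simplified]
    note f_bdd = N.lik_backward_lik_bounded[of t m, simplified]
    have \<alpha>': "(\<lambda>x. \<alpha> (Suc t) x (\<gamma> (Suc t))) \<in> state_space X \<rightarrow>\<^sub>M state_space X"
      using \<alpha>_meas[of "Suc t"] less_imp_le[OF \<gamma>] by simp
    have "continuous_on X (\<lambda>x. \<integral>y. ?f (\<alpha> (Suc t) y (\<gamma> (Suc t))) \<partial>kern M (Suc t) x)"
      by (intro continuous_on_tv_continuous_kernel kern tv comp_bounded f_bdd
          measurable_compose[OF \<alpha>' f_meas]) (simp_all add: \<gamma> less_imp_le)
    then show ?thesis
      unfolding Suc backward_lik.simps lik_nudged
      by (rule continuous_on_eq) (simp add: integral_kern_nudged[where \<alpha>=\<alpha> and \<gamma>=\<gamma>, OF \<alpha>' _ _ f_meas])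
  qed simp
  have backward_nudged: "(\<integral>x. backward_lik (?N \<gamma>) (Suc n) t x \<partial>filtering M t)
      = (\<integral>y. lik M (Suc t) (\<alpha> (Suc t) y (\<gamma> (Suc t)))
          * backward_lik (?N \<gamma>) n (Suc t) (\<alpha> (Suc t) y (\<gamma> (Suc t))) \<partial>predictive M (Suc t))"
    if \<gamma>: "\<And>s. 0 < \<gamma> s" for \<gamma> n t
  proof -
    interpret N: bounded_ssm X "?N \<gamma>" by (rule N[OF \<gamma>])
    note f_meas = N.lik_backward_lik_measurable[of t n, simplified]
    note f_bdd = N.lik_backward_lik_bounded[of t n, simplified]
    have \<alpha>': "(\<lambda>x. \<alpha> (Suc t) x (\<gamma> (Suc t))) \<in> state_space X \<rightarrow>\<^sub>M state_space X"
      using \<alpha>_meas[of "Suc t"] less_imp_le[OF \<gamma>] by simp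
    have c0: "0 \<le> \<gamma> (Suc t)" using \<gamma>[of "Suc t"] by simp
    show ?thesis
      by (subst integral_predictive[OF measurable_compose[OF \<alpha>' f_meas] comp_bounded[OF _ c0 f_bdd]], simp)
        (auto intro: Bochner_Integration.integral_cong[OF refl]
          simp: filtering_space integral_kern_nudged[where \<alpha>=\<alpha> and \<gamma>=\<gamma>, OF \<alpha>' _ _ f_meas])
  qed
  \<comment> \<open>The right-hand side of the inequality is the evidence of the hybrid nudged at
    the times \<open>t + 1\<close> to \<open>T\<close>. The induction on \<open>n\<close> runs
    backwards in \<open>t\<close>.\<close>
  have "\<exists>\<gamma>. (\<forall>s. 0 < \<gamma> s) \<and>
      evidence M T < evidence M t * (\<integral>x. backward_lik (?N \<gamma>) (Suc n) t x \<partial>filtering M t)"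
    if "Suc n + t = T" for n t
    using that
  proof (induction n arbitrary: t)
    case 0
    then have T: "T = Suc t" by simp
    obtain \<Gamma> where \<Gamma>: "0 < \<Gamma>" and incr: "\<And>c. 0 < c \<Longrightarrow> c < \<Gamma> \<Longrightarrow>
        0 < (\<integral>x. (lik M T (\<alpha> T x c) - lik M T x) \<partial>predictive M T)"
      using nudging \<open>1 \<le> T\<close> unfolding nudging_family_def by (metis greaterThanLessThan_iff)
    \<comment> \<open>Only the value at \<open>T\<close> enters here; the values at the times 1 to
      \<open>T - 1\<close> are replaced in the induction steps.\<close>
    define \<gamma> :: "nat \<Rightarrow> real" where "\<gamma> = (\<lambda>_. \<Gamma> / 2)"
    have \<gamma>: "0 < \<gamma> s" for s using \<Gamma> by (simp add: \<gamma>_def)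
    have c0: "0 \<le> \<Gamma> / 2" using \<Gamma> by simp
    note \<xi> = predictive_subprob[of t, folded T]
    have int: "integrable (predictive M T) (lik M T)"
        "integrable (predictive M T) (\<lambda>x. lik M T (\<alpha> T x (\<Gamma> / 2)))"
      by (intro integrable_bounded_state_space[OF \<xi>] lik_measurable lik_bounded \<open>1 \<le> T\<close> comp_bounded c0
          measurable_compose[OF \<alpha>_meas lik_measurable])+
    \<comment> \<open>Multiplying by a positive evidence keeps the gain from condition (3)
      strict.\<close>
    have "0 < evidence M t"
      unfolding evidence_def by (intro prod_pos) (simp add: pos)
    moreover have "norm_const M T < (\<integral>x. lik M T (\<alpha> T x (\<Gamma> / 2)) \<partial>predictive M T)"
      using incr[of "\<Gamma> / 2"] \<Gamma> int by (simp add: norm_const_def)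
    ultimately have "evidence M T < evidence M t * (\<integral>x. lik M T (\<alpha> T x (\<Gamma> / 2)) \<partial>predictive M T)"
      by (simp add: T evidence_Suc)
    then show ?case
      using \<gamma> backward_nudged[of \<gamma> t 0, OF \<gamma>] by (intro exI[of _ \<gamma>]) (simp add: T \<gamma>_def del: backward_lik.simps(2))
  next
    case (Suc n)
    then obtain \<gamma> where \<gamma>: "\<And>s. 0 < \<gamma> s" and less:
      "evidence M T < evidence M (Suc t) * (\<integral>x. backward_lik (?N \<gamma>) (Suc n) (Suc t) x \<partial>filtering M (Suc t))"
      by (metis add_Suc_shift)
    interpret N: bounded_ssm X "?N \<gamma>" by (rule N[OF \<gamma>])
    define f where "f y = lik M (Suc t) y * backward_lik (?N \<gamma>) (Suc n) (Suc t) y" for y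
    have f_meas: "f \<in> borel_measurable (state_space X)"
      unfolding f_def using N.lik_backward_lik_measurable[of t "Suc n"] by (simp del: backward_lik.simps)
    have f_bdd: "bounded (f ` X)"
      unfolding f_def using N.lik_backward_lik_bounded[of t "Suc n"] by (simp del: backward_lik.simps)
    have f_cont: "continuous_on X f"
      unfolding f_def by (intro continuous_on_mult lik_cont cont \<gamma>) simp
    define \<xi> where "\<xi> = predictive M (Suc t)"
    have \<xi>: "\<xi> \<in> space (subprob_algebra (state_space X))"
      unfolding \<xi>_def by (rule predictive_subprob)
    then have s: "sets \<xi> = sets (state_space X)" and "subprob_space \<xi>"
      by (auto simp: space_subprob_algebra)
    interpret \<xi>: subprob_space \<xi> by fact
    have sp: "space \<xi> = X" using sets_eq_imp_space_eq[OF s] by simp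
    \<comment> \<open>The update at time \<open>Suc t\<close> is moved into the integrand. The bound
      now concerns the predictive law with the state at \<open>Suc t\<close> not yet nudged.\<close>
    have less': "evidence M T < evidence M t * (\<integral>x. f x \<partial>\<xi>)"
      using less evidence_integral_filtering_Suc[OF N.backward_lik_measurable N.backward_lik_bounded]
      by (simp add: f_def \<xi>_def del: backward_lik.simps filtering.simps)
    obtain B where B: "\<And>x. x \<in> X \<Longrightarrow> \<bar>f x\<bar> \<le> B" using f_bdd unfolding bounded_real_image by blast
    \<comment> \<open>Candidate nudges at time \<open>Suc t\<close>: positive, and tending to 0
      along a sequence so that dominated convergence applies.\<close>
    let ?c = "\<lambda>k. inverse (real (Suc k))"
    have c: "filterlim ?c (at_right 0) sequentially"
      unfolding filterlim_at using LIMSEQ_inverse_real_of_nat by simp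
    have "(\<lambda>k. \<integral>x. f (\<alpha> (Suc t) x (?c k)) \<partial>\<xi>) \<longlonglongrightarrow> (\<integral>x. f x \<partial>\<xi>)"
    proof (rule integral_dominated_convergence[where w="\<lambda>_. B"])
      show "f \<in> borel_measurable \<xi>" using f_meas s by (simp cong: measurable_cong_sets)
      show "(\<lambda>x. f (\<alpha> (Suc t) x (?c k))) \<in> borel_measurable \<xi>" for k
        using measurable_compose[OF \<alpha>_meas f_meas, of "Suc t" "?c k"] s by (simp cong: measurable_cong_sets)
      show "AE x in \<xi>. (\<lambda>k. f (\<alpha> (Suc t) x (?c k))) \<longlonglongrightarrow> f x"
      proof (rule AE_I2)
        fix x assume "x \<in> space \<xi>"
        then have x: "x \<in> X" by (simp add: sp)
        show "(\<lambda>k. f (\<alpha> (Suc t) x (?c k))) \<longlonglongrightarrow> f x"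
          by (rule continuous_on_tendsto_compose[OF f_cont filterlim_compose[OF \<alpha>_lim c] x])
            (use x \<alpha>_in in auto)
      qed
      show "AE x in \<xi>. norm (f (\<alpha> (Suc t) x (?c k))) \<le> B" for k
        by (rule AE_I2) (simp add: B \<alpha>_in sp)
    qed simp
    then have "(\<lambda>k. evidence M t * (\<integral>x. f (\<alpha> (Suc t) x (?c k)) \<partial>\<xi>))
        \<longlonglongrightarrow> evidence M t * (\<integral>x. f x \<partial>\<xi>)"
      by (intro tendsto_mult_left)
    \<comment> \<open>The limit lies strictly above \<open>evidence M T\<close>, so a sufficiently
      small nudge stays above it too.\<close>
    from order_tendstoD(1)[OF this less'] obtain k where k:
        "evidence M T < evidence M t * (\<integral>x. f (\<alpha> (Suc t) x (?c k)) \<partial>\<xi>)"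
      by (auto simp: eventually_sequentially)
    define \<gamma>' where "\<gamma>' = \<gamma>(Suc t := ?c k)"
    have \<gamma>': "0 < \<gamma>' s" for s by (simp add: \<gamma>'_def \<gamma>)
    have "backward_lik (?N \<gamma>') (Suc n) (Suc t) = backward_lik (?N \<gamma>) (Suc n) (Suc t)"
      by (rule backward_lik_nudged_cong) (simp add: \<gamma>'_def)
    then have "(\<integral>x. backward_lik (?N \<gamma>') (Suc (Suc n)) t x \<partial>filtering M t)
        = (\<integral>x. f (\<alpha> (Suc t) x (?c k)) \<partial>\<xi>)"
      using backward_nudged[of \<gamma>' t "Suc n", OF \<gamma>'] by (simp add: f_def \<xi>_def \<gamma>'_def del: backward_lik.simps)
    then show ?case using k \<gamma>' by (intro exI[of _ \<gamma>']) (simp del: backward_lik.simps)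
  qed
  \<comment> \<open>At \<open>t = 0\<close> the filter is the initial law and the evidence is the
    empty product 1, so the hybrid is the fully nudged model.\<close>
  from this[of "T - 1" 0] T obtain \<gamma> where \<gamma>: "\<And>s. 0 < \<gamma> s"
    and "evidence M T < (\<integral>x. backward_lik (?N \<gamma>) T 0 x \<partial>init M)"
    by (auto simp: evidence_def simp del: backward_lik.simps)
  then have "evidence M T < evidence (?N \<gamma>) T"
    using bounded_ssm.evidence_eq_integral_backward_lik[OF N[of \<gamma>, OF \<gamma>], where n=T] by simp
  then show thesis by (rule that[OF \<gamma>])
qed

text \<open>Positivity of the nudged normalising constants is part of the conclusion, since only
  then does the nudged evidence have its intended meaning.\<close>

theorem corollary3p2:
  fixes X :: "(real ^ 'd) set"
    and \<Theta> :: "(real ^ 'p) set"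
    and M :: "real ^ 'p \<Rightarrow> (real ^ 'd) ssm"
    and C0 :: real and G \<kappa> :: "nat \<Rightarrow> real"
    and T :: nat and L :: real
    and \<theta>star \<theta> :: "real ^ 'p"
    and \<alpha> :: "nat \<Rightarrow> real ^ 'd \<Rightarrow> real \<Rightarrow> real ^ 'd"
  assumes model: "\<And>\<theta>. \<theta> \<in> \<Theta> \<Longrightarrow> state_space_model X (M \<theta>)"
    and A_lik: "\<And>\<theta> t. \<theta> \<in> \<Theta> \<Longrightarrow> 1 \<le> t \<Longrightarrow>
      continuous_on X (lik (M \<theta>) t) \<and> bounded (lik (M \<theta>) t ` X)"
    and A_kern: "\<And>\<theta> t. \<theta> \<in> \<Theta> \<Longrightarrow> 1 \<le> t \<Longrightarrow> tv_continuous_kernel X (kern (M \<theta>) t)"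
    and B_init: "\<And>\<theta> \<theta>'. \<theta> \<in> \<Theta> \<Longrightarrow> \<theta>' \<in> \<Theta> \<Longrightarrow>
      tv_dist X (init (M \<theta>)) (init (M \<theta>')) \<le> C0 * norm (\<theta> - \<theta>')"
    and B_lik: "\<And>\<theta> \<theta>' t. \<theta> \<in> \<Theta> \<Longrightarrow> \<theta>' \<in> \<Theta> \<Longrightarrow> 1 \<le> t \<Longrightarrow>
      sup_norm X (\<lambda>x. lik (M \<theta>) t x - lik (M \<theta>') t x) \<le> G t * norm (\<theta> - \<theta>')"
    and B_kern: "\<And>\<theta> \<theta>' x t. \<theta> \<in> \<Theta> \<Longrightarrow> \<theta>' \<in> \<Theta> \<Longrightarrow> x \<in> X \<Longrightarrow> 1 \<le> t \<Longrightarrow>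
      tv_dist X (kern (M \<theta>) t x) (kern (M \<theta>') t x) \<le> \<kappa> t * norm (\<theta> - \<theta>')"
    and lipschitz: "\<And>\<theta> \<theta>'. \<theta> \<in> \<Theta> \<Longrightarrow> \<theta>' \<in> \<Theta> \<Longrightarrow>
      \<bar>evidence (M \<theta>) T - evidence (M \<theta>') T\<bar> \<le> L * norm (\<theta> - \<theta>')"
    and mle: "is_arg_max (\<lambda>\<theta>. evidence (M \<theta>) T) (\<lambda>\<theta>. \<theta> \<in> \<Theta>) \<theta>star"
    and theta: "\<theta> \<in> \<Theta>"
    and nudging: "nudging_family X (M \<theta>) \<alpha>"
  shows "\<exists>\<gamma> :: nat \<Rightarrow> real.
    (\<forall>t\<in>{1..T}. 0 < \<gamma> t) \<and>
    (\<forall>t\<in>{1..T}. 0 < norm_const (nudged X (M \<theta>) \<alpha> \<gamma>) t) \<and>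
    (let \<Delta> = evidence (nudged X (M \<theta>) \<alpha> \<gamma>) T - evidence (M \<theta>) T
     in 0 \<le> \<Delta> \<and>
        evidence (nudged X (M \<theta>) \<alpha> \<gamma>) T
          \<in> {evidence (M \<theta>star) T - L * norm (\<theta>star - \<theta>) .. evidence (M \<theta>star) T + \<Delta>})"
proof -
  \<comment> \<open>Adding the gain of the nudge to the first inequality gives the upper end of the
    interval. The second, with a nonnegative gain, gives the lower end.\<close>
  have ev: "evidence (M \<theta>) T \<le> evidence (M \<theta>star) T"
    "evidence (M \<theta>star) T - L * norm (\<theta>star - \<theta>) \<le> evidence (M \<theta>) T"
    using mle theta lipschitz[of \<theta>star \<theta>] by (auto simp: is_arg_max_linorder abs_le_iff)
  show ?thesis
  \<comment> \<open>For \<open>T = 0\<close> every evidence is the empty product 1, so there is no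
    strict gain to be had and any parameters serve.\<close>
  proof (cases "T = 0")
    case True
    then show ?thesis
      using ev by (intro exI[of _ "\<lambda>_. 1"]) (simp add: evidence_def)
  next
    case False
    have M: "bounded_ssm X (M \<theta>)"
      using model[OF theta] A_lik[OF theta] by unfold_locales (auto simp: state_space_model_def)
    have pos: "0 < norm_const (M \<theta>) t" if "1 \<le> t" for t
      using model[OF theta] that by (simp add: state_space_model_def)
    obtain \<gamma> where \<gamma>: "\<And>t. 0 < \<gamma> t"
      and incr: "evidence (M \<theta>) T < evidence (nudged X (M \<theta>) \<alpha> \<gamma>) T"
      using exists_nudging_increasing_evidence[OF M pos _ _ nudging, of T] A_lik A_kern theta False
      by (metis One_nat_def Suc_leI neq0_conv)
    interpret N: bounded_ssm X "nudged X (M \<theta>) \<alpha> \<gamma>"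
      using nudging \<gamma> by (intro bounded_ssm.bounded_ssm_nudged[OF M]) (simp add: nudging_family_def less_imp_le)
    \<comment> \<open>The nudged evidence exceeds a positive number, so none of its factors is 0;
      being nonnegative, they are all positive.\<close>
    have "0 < evidence (M \<theta>) T"
      unfolding evidence_def by (intro prod_pos) (simp add: pos)
    with incr have "evidence (nudged X (M \<theta>) \<alpha> \<gamma>) T \<noteq> 0" by linarith
    then have "norm_const (nudged X (M \<theta>) \<alpha> \<gamma>) t \<noteq> 0" if "t \<in> {1..T}" for t
      using that by (auto simp: evidence_def)
    then have "0 < norm_const (nudged X (M \<theta>) \<alpha> \<gamma>) t" if "t \<in> {1..T}" for t
      using that N.norm_const_nonneg[of t] by (simp add: less_le)
    then show ?thesis
      using \<gamma> incr ev by (intro exI[of _ \<gamma>]) (auto simp: Let_def)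
  qed
qed

end
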